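(* Let $m,n$ be positive integers with $m<n/2$, and let $K_{n,m}$ be the Kneser graph. Then $K_{n,m}$ admits a uniform edge coloring with which $K_{n,m}$ is a uniformly colored graph of type $$(p,q,r)=\left(\binom{n}{2m},\ \binom{n}{m},\ \tfrac12\binom{2m}{m}\right).$$
   Context: The Kneser graph $K_{n,m}$ has as vertices the subsets of $\{1,\dots,n\}$ of cardinality $m$; two vertices are joined by an edge if and only if they are disjoint sets. A uniform edge coloring of type $(p,q,r)$ ($p,q,r$ positive integers) with degree $s\ge 1$ on an undirected $s$-regular graph $(V,E)$ (without loops or multiple edges) with $q$ vertices is a surjective map $c:E\to S$, $|S|=p$, such that adjacent edges have different colors (the coloring is proper) and $|c^{-1}(\{k\})|=r$ for every $k\in S$. A graph with such a coloring is a uniformly colored graph of type $(p,q,r)$. *)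

theory Defs
  imports Complex_Main
begin

text \<open>
  Undirected graphs without loops or multiple edges are given by a vertex set \<open>V\<close> and a set
  \<open>E\<close> of two-element subsets of \<open>V\<close>.
\<close>

definition simple_graph :: "'a set \<Rightarrow> 'a set set \<Rightarrow> bool" where
  "simple_graph V E \<longleftrightarrow> (\<forall>e\<in>E. e \<subseteq> V \<and> card e = 2)"

text \<open>The finiteness requirement excludes the convention that infinite sets have cardinality 0.\<close>

definition regular_graph :: "nat \<Rightarrow> 'a set \<Rightarrow> 'a set set \<Rightarrow> bool" where
  "regular_graph s V E \<longleftrightarrow>
     simple_graph V E \<and> (\<forall>v\<in>V. finite {e\<in>E. v \<in> e} \<and> card {e\<in>E. v \<in> e} = s)"

definition proper_edge_coloring :: "'a set set \<Rightarrow> ('a set \<Rightarrow> 'c) \<Rightarrow> bool" where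
  "proper_edge_coloring E c \<longleftrightarrow>
     (\<forall>e\<in>E. \<forall>f\<in>E. e \<noteq> f \<and> e \<inter> f \<noteq> {} \<longrightarrow> c e \<noteq> c f)"

text \<open>
  The coloring \<open>c : E \<rightarrow> S\<close> is a total function of which only the values on \<open>E\<close> matter.
\<close>

definition uniform_edge_coloring ::
  "'a set \<Rightarrow> 'a set set \<Rightarrow> ('a set \<Rightarrow> 'c) \<Rightarrow> 'c set \<Rightarrow> nat \<Rightarrow> nat \<times> nat \<times> nat \<Rightarrow> bool" where
  "uniform_edge_coloring V E c S s = (\<lambda>(p, q, r).
     p > 0 \<and> q > 0 \<and> r > 0 \<and> s \<ge> 1 \<and>
     regular_graph s V E \<and> finite V \<and> card V = q \<and>
     finite S \<and> card S = p \<and> c ` E = S \<and>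
     proper_edge_coloring E c \<and>
     (\<forall>k\<in>S. card {e\<in>E. c e = k} = r))"

text \<open>
  Color sets are finite, so taking the colors to be natural numbers loses no generality.
\<close>

definition uniformly_colored_graph ::
  "'a set \<Rightarrow> 'a set set \<Rightarrow> (nat \<times> nat \<times> nat) \<Rightarrow> ('a set \<Rightarrow> nat) \<Rightarrow> bool" where
  "uniformly_colored_graph V E t c \<longleftrightarrow>
     (\<exists>S s. uniform_edge_coloring V E c S s t)"

definition kneser_vertices :: "nat \<Rightarrow> nat \<Rightarrow> nat set set" where
  "kneser_vertices n m = {A. A \<subseteq> {1..n} \<and> card A = m}"

definition kneser_edges :: "nat \<Rightarrow> nat \<Rightarrow> nat set set set" where
  "kneser_edges n m =
     {{A, B} |A B. A \<in> kneser_vertices n m \<and> B \<in> kneser_vertices n m \<and> A \<inter> B = {}}"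

end

theory Submission
  imports Defs
begin

text \<open>
  Color the edge \<open>{A, B}\<close> by the \<open>2m\<close>-set \<open>A \<union> B\<close>. Two edges with a common endpoint \<open>A\<close> and the
  same union \<open>U\<close> both have second endpoint \<open>U - A\<close>, so the coloring is proper. For the same reason
  the edges of color \<open>U\<close> partition the \<open>m\<close>-subsets of \<open>U\<close> into pairs of complementary sets.
\<close>

text \<open>Edges are unordered, so by symmetry any chosen endpoint may be taken as the first of the
  two disjoint sets.\<close>

lemma kneser_edgeE:
  assumes "e \<in> kneser_edges n m" "A \<in> e"
  obtains B where "e = {A, B}" "A \<subseteq> {1..n}" "card A = m" "B \<subseteq> {1..n}" "card B = m" "A \<inter> B = {}"
proof -
  obtain A' B' where e: "e = {A', B'}" and V: "A' \<in> kneser_vertices n m" "B' \<in> kneser_vertices n m"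
    and disj: "A' \<inter> B' = {}"
    using assms(1) unfolding kneser_edges_def by blast
  from assms(2) consider "A = A'" | "A = B'" unfolding e by blast
  then show thesis
  proof cases
    case 1
    then show ?thesis using that[of B'] e V disj by (simp add: kneser_vertices_def)
  next
    case 2
    then show ?thesis using that[of A'] e V disj
      by (simp add: kneser_vertices_def insert_commute Int_commute)
  qed
qed

lemma kneser_edgeI:
  assumes "A \<subseteq> {1..n}" "card A = m" "B \<subseteq> {1..n}" "card B = m" "A \<inter> B = {}"
  shows "{A, B} \<in> kneser_edges n m"
  using assms unfolding kneser_edges_def kneser_vertices_def by blast

text \<open>Used twice: it gives properness of the coloring, and it makes the edges within one color
  class pairwise disjoint.\<close>

lemma kneser_edge_eqI:
  assumes "d \<in> kneser_edges n m" "e \<in> kneser_edges n m" "A \<in> d" "A \<in> e" "\<Union>d = \<Union>e"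
  shows "d = e"
proof -
  obtain B where "d = {A, B}" "A \<inter> B = {}"
    using kneser_edgeE[OF assms(1,3)] .
  moreover obtain C where "e = {A, C}" "A \<inter> C = {}"
    using kneser_edgeE[OF assms(2,4)] .
  moreover from calculation assms(5) have "B = C" by auto
  ultimately show ?thesis by simp
qed

lemma finite_kneser_vertices: "finite (kneser_vertices n m)"
  unfolding kneser_vertices_def by (rule finite_subset[of _ "Pow {1..n}"]) auto

lemma card_kneser_vertices: "card (kneser_vertices n m) = n choose m"
  unfolding kneser_vertices_def using n_subsets[of "{1..n}" m] by simp

lemma kneser_edges_subset_Pow: "kneser_edges n m \<subseteq> Pow (kneser_vertices n m)"
  unfolding kneser_edges_def by auto

lemma finite_kneser_edges: "finite (kneser_edges n m)"
  using finite_subset[OF kneser_edges_subset_Pow] finite_kneser_vertices by blast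

lemma card_kneser_edge:
  assumes "e \<in> kneser_edges n m" "m > 0"
  shows "card e = 2"
proof -
  obtain A B where "e = {A, B}" "card A = m" "A \<inter> B = {}"
    using assms(1) unfolding kneser_edges_def kneser_vertices_def by blast
  \<comment> \<open>A set disjoint from itself is empty, which \<open>m > 0\<close> rules out; so
    there are no loops.\<close>
  moreover from this have "A \<noteq> B" using assms(2) by auto
  ultimately show ?thesis by simp
qed

lemma Union_kneser_edge:
  assumes "e \<in> kneser_edges n m"
  shows "\<Union>e \<in> kneser_vertices n (2 * m)"
proof -
  obtain A B where e: "e = {A, B}" "A \<subseteq> {1..n}" "card A = m" "B \<subseteq> {1..n}" "card B = m" "A \<inter> B = {}"
    using assms unfolding kneser_edges_def kneser_vertices_def by blast
  then have "card (A \<union> B) = 2 * m"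
    using card_Un_disjoint[of A B] finite_subset[of _ "{1..n}"] by auto
  then show ?thesis using e unfolding kneser_vertices_def by auto
qed

text \<open>The neighbors of \<open>A\<close> are the \<open>m\<close>-subsets of its complement in
  \<open>{1..n}\<close>, a set with \<open>n - m\<close> elements.\<close>

lemma regular_graph_kneser:
  assumes "m > 0"
  shows "regular_graph ((n - m) choose m) (kneser_vertices n m) (kneser_edges n m)"
  unfolding regular_graph_def simple_graph_def
proof (intro conjI ballI)
  fix e assume "e \<in> kneser_edges n m"
  then show "e \<subseteq> kneser_vertices n m" "card e = 2"
    using kneser_edges_subset_Pow card_kneser_edge[of e n m] assms by auto
next
  fix A assume A: "A \<in> kneser_vertices n m"
  let ?N = "{B. B \<subseteq> {1..n} - A \<and> card B = m}"
  show "finite {e \<in> kneser_edges n m. A \<in> e}"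
    using finite_kneser_edges by simp
  have "{e \<in> kneser_edges n m. A \<in> e} = (\<lambda>B. {A, B}) ` ?N"
  proof (intro equalityI subsetI)
    fix e assume "e \<in> {e \<in> kneser_edges n m. A \<in> e}"
    then obtain B where "e = {A, B}" "B \<subseteq> {1..n}" "card B = m" "A \<inter> B = {}"
      using kneser_edgeE[of e n m A] by auto
    then show "e \<in> (\<lambda>B. {A, B}) ` ?N"
      by blast
  next
    fix e assume "e \<in> (\<lambda>B. {A, B}) ` ?N"
    then obtain B where "e = {A, B}" "B \<subseteq> {1..n} - A" "card B = m" by blast
    moreover from this have "{A, B} \<in> kneser_edges n m"
      using A by (intro kneser_edgeI) (auto simp: kneser_vertices_def)
    ultimately show "e \<in> {e \<in> kneser_edges n m. A \<in> e}" by simp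
  qed
  moreover have "inj_on (\<lambda>B. {A, B}) ?N"
    by (auto simp: inj_on_def doubleton_eq_iff)
  ultimately have "card {e \<in> kneser_edges n m. A \<in> e} = card ?N"
    by (simp add: card_image)
  also have "\<dots> = card ({1..n} - A) choose m"
    by (rule n_subsets) simp
  also have "card ({1..n} - A) = n - m"
    using A by (simp add: kneser_vertices_def card_Diff_subset finite_subset[of A "{1..n}"])
  finally show "card {e \<in> kneser_edges n m. A \<in> e} = (n - m) choose m" .
qed

text \<open>The endpoints of the edges with union \<open>U\<close> are counted in two ways. Keeping
  the factor 2 on the left avoids division and also shows that the binomial coefficient is
  even.\<close>

lemma card_kneser_edges_Union:
  assumes "m > 0" "U \<in> kneser_vertices n (2 * m)"
  shows "2 * card {e \<in> kneser_edges n m. \<Union>e = U} = (2 * m) choose m"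
proof -
  let ?C = "{e \<in> kneser_edges n m. \<Union>e = U}"
  let ?M = "{A. A \<subseteq> U \<and> card A = m}"
  have U: "U \<subseteq> {1..n}" "card U = 2 * m" "finite U"
    using assms(2) finite_subset[of U "{1..n}"] by (auto simp: kneser_vertices_def)
  have Union_C: "\<Union>?C = ?M"
  proof (intro equalityI subsetI)
    fix A assume "A \<in> \<Union>?C"
    then obtain e where e: "e \<in> kneser_edges n m" "A \<in> e" "\<Union>e = U" by blast
    then have "card A = m" by (metis kneser_edgeE)
    with e show "A \<in> ?M" by blast
  next
    fix A assume A: "A \<in> ?M"
    \<comment> \<open>Since \<open>U\<close> has \<open>2 * m\<close> elements, the complement of
      \<open>A\<close> in \<open>U\<close> is again a vertex, and it supplies the edge through
      \<open>A\<close>.\<close>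
    then have "card (U - A) = m"
      using U card_Diff_subset[of A U] finite_subset[of A U] by auto
    then have "{A, U - A} \<in> kneser_edges n m"
      using A U by (intro kneser_edgeI) auto
    then show "A \<in> \<Union>?C" using A by blast
  qed
  have "2 * card ?C = card (\<Union>?C)"
  proof (rule card_partition)
    show "finite ?C" using finite_kneser_edges by simp
    show "finite (\<Union>?C)" unfolding Union_C using U(3) by simp
    show "card e = 2" if "e \<in> ?C" for e
      using that card_kneser_edge[of e n m] assms(1) by simp
    show "e \<inter> f = {}" if "e \<in> ?C" "f \<in> ?C" "e \<noteq> f" for e f
      using that kneser_edge_eqI[of e n m f] by auto
  qed
  also have "\<dots> = (2 * m) choose m"
    unfolding Union_C using n_subsets[OF U(3)] U(2) by simp
  finally show ?thesis .
qed

text \<open>The natural color of an edge is its union; \<open>f\<close> encodes these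
  \<open>2m\<close>-sets as colors of another type, and injectivity ensures that no two of them are
  merged.\<close>

lemma proper_edge_coloring_kneser:
  assumes "inj_on f (kneser_vertices n (2 * m))"
  shows "proper_edge_coloring (kneser_edges n m) (\<lambda>e. f (\<Union>e))"
  unfolding proper_edge_coloring_def
proof (intro ballI impI notI)
  fix d e assume de: "d \<in> kneser_edges n m" "e \<in> kneser_edges n m" "d \<noteq> e \<and> d \<inter> e \<noteq> {}"
    and "f (\<Union>d) = f (\<Union>e)"
  then have "\<Union>d = \<Union>e"
    using inj_onD[OF assms] Union_kneser_edge by blast
  moreover obtain A where "A \<in> d" "A \<in> e" using de by blast
  ultimately show False
    using de kneser_edge_eqI by blast
qed

theorem proposition5p1:
  fixes m n :: nat
  assumes "m > 0" and "n > 0" and "real m < real n / 2"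
  shows "\<exists>r c. real r = 1 / 2 * real ((2 * m) choose m) \<and>
    uniformly_colored_graph (kneser_vertices n m) (kneser_edges n m)
      (n choose (2 * m), n choose m, r) c"
proof -
  let ?V = "kneser_vertices n m" and ?E = "kneser_edges n m" and ?P = "kneser_vertices n (2 * m)"
  have mn: "2 * m < n" using assms(3) by linarith
  \<comment> \<open>\<open>uniformly_colored_graph\<close> asks for colors in \<open>nat\<close>, so
    the finitely many \<open>2m\<close>-sets are numbered.\<close>
  obtain f :: "nat set \<Rightarrow> nat" where inj: "inj_on f ?P"
    using finite_imp_inj_to_nat_seg[OF finite_kneser_vertices] by metis
  define c where "c e = f (\<Union>e)" for e :: "nat set set"
  define r where "r = ((2 * m) choose m) div 2"
  have class_eq: "{e \<in> ?E. c e = f U} = {e \<in> ?E. \<Union>e = U}" if "U \<in> ?P" for U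
    unfolding c_def using that inj_on_eq_iff[OF inj] Union_kneser_edge by blast
  \<comment> \<open>One color class is enough to see that the binomial coefficient is even, so the
    \<open>div 2\<close> in \<open>r\<close> is exact.\<close>
  have "{1..2 * m} \<in> ?P" using mn by (auto simp: kneser_vertices_def)
  then have r: "2 * r = (2 * m) choose m"
    unfolding r_def using card_kneser_edges_Union[OF assms(1)] by (metis dvd_triv_left dvd_mult_div_cancel)
  then have r_pos: "r > 0"
    using zero_less_binomial[of m "2 * m"] by linarith
  have card_class: "card {e \<in> ?E. c e = f U} = r" if "U \<in> ?P" for U
    using card_kneser_edges_Union[OF assms(1) that] r class_eq[OF that] by simp
  have "c ` ?E = f ` ?P"
  proof (intro equalityI subsetI)
    fix k assume "k \<in> c ` ?E"
    then show "k \<in> f ` ?P" unfolding c_def using Union_kneser_edge by blast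
  next
    fix k assume "k \<in> f ` ?P"
    \<comment> \<open>Every color is attained because its class has \<open>r > 0\<close>
      edges.\<close>
    then have "card {e \<in> ?E. c e = k} > 0" using card_class r_pos by auto
    then have "{e \<in> ?E. c e = k} \<noteq> {}" by (metis card.empty less_irrefl)
    then show "k \<in> c ` ?E" by blast
  qed
  \<comment> \<open>From \<open>2 * m < n\<close> follows \<open>m \<le> n - m\<close>, so the
    degree is at least 1; it also makes the numbers of colors and of vertices positive.\<close>
  then have "uniform_edge_coloring ?V ?E c (f ` ?P) ((n - m) choose m) (n choose (2 * m), n choose m, r)"
    unfolding uniform_edge_coloring_def
    using mn r_pos card_class regular_graph_kneser[OF assms(1)] finite_kneser_vertices
      card_kneser_vertices card_image[OF inj] card_kneser_vertices[of n "2 * m"]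
      proper_edge_coloring_kneser[OF inj, folded c_def]
    by (auto simp: Suc_le_eq)
  moreover have "real r = 1 / 2 * real ((2 * m) choose m)"
    unfolding r[symmetric] by simp
  ultimately show ?thesis unfolding uniformly_colored_graph_def by blast
qed

end
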